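(* Define $a(1)=1$ and $a(n)=1+\sum_m a(m)$ for $n>1$, the sum over all proper divisors $m$ of $n$ (positive divisors $m<n$). For $k\ge 0$ let $p_1,\dots,p_k$ be distinct primes and $a_k=a(p_1p_2\cdots p_k)$ (so $a_0=a(1)=1$; $a_k$ does not depend on the choice of the distinct primes). Then the exponential generating function of the sequence $(a_k)_{k\ge0}$ is $$\sum_{k\ge 0} a_k\frac{x^k}{k!}=\frac{e^x}{2-e^x}.$$
   Context: $a(n)$ is called the number of recursive divisors of $n$. *)

theory Defs
  imports "HOL-Computational_Algebra.Computational_Algebra"
begin

(* The argument 0 is outside the intended domain; the equation gives it the value 1. *)
function rec_divisors :: "nat \<Rightarrow> nat" where
  "rec_divisors n =
     (if n = 1 then 1 else 1 + (\<Sum>m | 0 < m \<and> m < n \<and> m dvd n. rec_divisors m))"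
  by auto
termination
  by (relation "measure id") auto

declare rec_divisors.simps [simp del]

end

theory Submission
  imports Defs
begin

text \<open>
  The divisors of a product of distinct primes correspond to the subsets of the set of these
  primes. Hence \<open>a\<^sub>k = 1 + (\<Sum>j<k. (k choose j) * a\<^sub>j)\<close>, that is
  \<open>2 * a\<^sub>k - (\<Sum>j\<le>k. (k choose j) * a\<^sub>j) = 1\<close>, which says that the exponential generating
  function \<open>F\<close> satisfies \<open>F * (2 - exp x) = exp x\<close>.
\<close>

text \<open>The values begin 1, 2, 6, 26; for \<open>k > 0\<close> they are twice the ordered Bell
  numbers. Recursing on the number of primes makes independence of their choice automatic.\<close>

function rec_divisors_primes :: "nat \<Rightarrow> nat" where
  "rec_divisors_primes k = 1 + (\<Sum>j<k. (k choose j) * rec_divisors_primes j)"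
  by auto
termination
  by (relation "measure id") auto

declare rec_divisors_primes.simps [simp del]

text \<open>At \<open>n = 1\<close> the sum is empty, so the case distinction of the definition
  disappears.\<close>

lemma rec_divisors_eq: "rec_divisors n = 1 + (\<Sum>m | 0 < m \<and> m < n \<and> m dvd n. rec_divisors m)"
proof (cases "n = 1")
  case True
  then have "{m. 0 < m \<and> m < n \<and> m dvd n} = {}"
    by auto
  with True show ?thesis
    by (simp add: rec_divisors.simps)
qed (subst rec_divisors.simps, simp)

text \<open>A left inverse exists: the set of prime divisors of \<open>\<Prod>A\<close> is
  \<open>A\<close> itself.\<close>

lemma inj_on_prod_primes:
  fixes Q :: "nat set"
  assumes "finite Q" "\<And>q. q \<in> Q \<Longrightarrow> prime q"
  shows "inj_on \<Prod> (Pow Q)"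
proof (rule inj_on_inverseI)
  fix A assume "A \<in> Pow Q"
  then have A: "finite A" "\<And>q. q \<in> A \<Longrightarrow> prime q"
    using assms finite_subset by auto
  have "p dvd \<Prod>A \<longleftrightarrow> p \<in> A" if "prime p" for p
    using that A by (metis dvd_refl prime_dvd_prod_iff primes_dvd_imp_eq)
  with A show "{p. prime p \<and> p dvd \<Prod>A} = A"
    by auto
qed

text \<open>Induction on \<open>Q\<close>: a divisor of \<open>q * \<Prod>Q\<close> factors as
  \<open>b * c\<close> with \<open>b dvd q\<close> and \<open>c dvd \<Prod>Q\<close>. Since
  \<open>q\<close> is prime, \<open>b\<close> is 1 or \<open>q\<close>, which decides whether
  \<open>q\<close> joins the subset obtained for \<open>c\<close>.\<close>

lemma dvd_prod_primes_imp_prod: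
  fixes Q :: "nat set"
  assumes "finite Q" "\<And>q. q \<in> Q \<Longrightarrow> prime q" "m dvd \<Prod>Q"
  shows "\<exists>A\<subseteq>Q. m = \<Prod>A"
  using assms
proof (induction Q arbitrary: m rule: finite_induct)
  case empty
  then show ?case by auto
next
  case (insert q Q)
  then have "m dvd q * \<Prod>Q" by simp
  then obtain b c where m: "m = b * c" "b dvd q" "c dvd \<Prod>Q"
    using division_decomp by blast
  with insert obtain A where A: "A \<subseteq> Q" "c = \<Prod>A"
    by (metis insertCI)
  then have "finite A" "q \<notin> A"
    using insert.hyps finite_subset by auto
  then have "\<Prod>(insert q A) = q * c"
    using A by simp
  moreover have "b = 1 \<or> b = q"
    using m(2) insert.prems(1) prime_nat_iff by auto
  ultimately show ?case
    using A m(1) by (metis insert_mono mult_1 subset_insertI2)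
qed

lemma proper_divisors_prod_primes:
  fixes Q :: "nat set"
  assumes "finite Q" "\<And>q. q \<in> Q \<Longrightarrow> prime q"
  shows "{m. 0 < m \<and> m < \<Prod>Q \<and> m dvd \<Prod>Q} = \<Prod> ` {A. A \<subset> Q}"
proof (intro equalityI subsetI)
  fix m assume "m \<in> {m. 0 < m \<and> m < \<Prod>Q \<and> m dvd \<Prod>Q}"
  then show "m \<in> \<Prod> ` {A. A \<subset> Q}"
    using dvd_prod_primes_imp_prod[OF assms, of m] by force
next
  have pos: "0 < \<Prod>Q"
    using assms by (auto intro!: prod_pos prime_gt_0_nat)
  fix m assume "m \<in> \<Prod> ` {A. A \<subset> Q}"
  then obtain A where A: "A \<subset> Q" "m = \<Prod>A" by auto
  then have dvd: "m dvd \<Prod>Q"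
    using assms(1) by (auto intro: prod_dvd_prod_subset)
  \<comment> \<open>Injectivity turns properness of the subset into properness of the
    divisor.\<close>
  have "m \<noteq> \<Prod>Q"
    using A inj_onD[OF inj_on_prod_primes[OF assms], of A Q] by auto
  with dvd pos show "m \<in> {m. 0 < m \<and> m < \<Prod>Q \<and> m dvd \<Prod>Q}"
    using dvd_imp_le[OF dvd pos] dvd_pos_nat[OF pos dvd] by auto
qed

text \<open>Group the proper subsets by cardinality, which is always below
  \<open>card Q\<close>.\<close>

lemma sum_card_psubsets:
  fixes f :: "nat \<Rightarrow> nat"
  assumes "finite Q"
  shows "(\<Sum>A | A \<subset> Q. f (card A)) = (\<Sum>j<card Q. (card Q choose j) * f j)"
proof -
  have fin: "finite {A. A \<subset> Q}"
    by (rule finite_subset[of _ "Pow Q"]) (use assms in auto)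
  have "card A < card Q" if "A \<subset> Q" for A
    using assms that by (rule psubset_card_mono)
  then have "(\<Sum>A | A \<subset> Q. f (card A)) = (\<Sum>j<card Q. \<Sum>A | A \<in> {A. A \<subset> Q} \<and> card A = j. f (card A))"
    using fin by (subst sum.group) blast+
  also have "\<dots> = (\<Sum>j<card Q. (card Q choose j) * f j)"
  proof (rule sum.cong[OF refl])
    fix j assume "j \<in> {..<card Q}"
    \<comment> \<open>As \<open>j < card Q\<close>, a subset of size \<open>j\<close> is
      automatically proper, so the binomial coefficient counts all of them.\<close>
    then have "{A. A \<in> {A. A \<subset> Q} \<and> card A = j} = {A. A \<subseteq> Q \<and> card A = j}"
      by auto
    then show "(\<Sum>A | A \<in> {A. A \<subset> Q} \<and> card A = j. f (card A)) = (card Q choose j) * f j"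
      using n_subsets[OF assms, of j] by simp
  qed
  finally show ?thesis .
qed

lemma rec_divisors_prod_primes:
  fixes Q :: "nat set"
  assumes "finite Q" "\<And>q. q \<in> Q \<Longrightarrow> prime q"
  shows "rec_divisors (\<Prod>Q) = rec_divisors_primes (card Q)"
  using assms
proof (induction Q rule: finite_psubset_induct)
  case (psubset Q)
  have "rec_divisors (\<Prod>Q) = 1 + (\<Sum>m\<in>\<Prod> ` {A. A \<subset> Q}. rec_divisors m)"
    using proper_divisors_prod_primes[of Q] psubset.hyps psubset.prems
    by (subst rec_divisors_eq) simp
  also have "(\<Sum>m\<in>\<Prod> ` {A. A \<subset> Q}. rec_divisors m) = (\<Sum>A | A \<subset> Q. rec_divisors (\<Prod>A))"
    using inj_on_subset[OF inj_on_prod_primes[of Q], of "{A. A \<subset> Q}"]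
      psubset.hyps psubset.prems by (subst sum.reindex) auto
  also have "\<dots> = (\<Sum>A | A \<subset> Q. rec_divisors_primes (card A))"
    using psubset.IH psubset.prems by (intro sum.cong) auto
  also have "\<dots> = (\<Sum>j<card Q. (card Q choose j) * rec_divisors_primes j)"
    by (rule sum_card_psubsets[OF psubset.hyps])
  finally show ?case
    by (simp add: rec_divisors_primes.simps[of "card Q"])
qed

lemma egf_rec_divisors_primes:
  "Abs_fps (\<lambda>k. real (rec_divisors_primes k) / fact k) = fps_exp 1 / (2 - fps_exp 1)"
proof -
  let ?F = "Abs_fps (\<lambda>k. real (rec_divisors_primes k) / fact k)"
  \<comment> \<open>The convolution is a binomial sum over \<open>j \<le> k\<close>. Its terms with
    \<open>j < k\<close> add up to \<open>a_k - 1\<close> by the recurrence, and the term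
    \<open>j = k\<close> contributes another \<open>a_k\<close>.\<close>
  have conv: "(?F * fps_exp 1) $ k = (2 * real (rec_divisors_primes k) - 1) / fact k" for k
  proof -
    have "(?F * fps_exp 1) $ k
        = (\<Sum>j\<le>k. real (rec_divisors_primes j) / fact j * (1 / fact (k - j)))"
      by (simp add: fps_mult_nth atLeast0AtMost)
    also have "\<dots> = (\<Sum>j\<le>k. real ((k choose j) * rec_divisors_primes j)) / fact k"
      unfolding sum_divide_distrib
      by (intro sum.cong) (auto simp: binomial_fact)
    also have "(\<Sum>j\<le>k. real ((k choose j) * rec_divisors_primes j))
        = real (\<Sum>j<k. (k choose j) * rec_divisors_primes j) + real (rec_divisors_primes k)"
      by (simp add: lessThan_Suc_atMost[symmetric])
    also have "\<dots> = 2 * real (rec_divisors_primes k) - 1"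
      using rec_divisors_primes.simps[of k] by linarith
    finally show ?thesis .
  qed
  have "?F * (2 - fps_exp 1) = fps_exp 1"
  proof (rule fps_ext)
    fix k
    have "(?F * (2 - fps_exp 1)) $ k = 2 * ?F $ k - (?F * fps_exp 1) $ k"
      by (simp add: right_diff_distrib numeral_fps_const mult.commute[of ?F])
    then show "(?F * (2 - fps_exp 1)) $ k = fps_exp 1 $ k"
      unfolding conv by (simp add: diff_divide_distrib)
  qed
  \<comment> \<open>The witness is index 0: the constant coefficient is 2 - 1 = 1.\<close>
  moreover have "(2 - fps_exp 1 :: real fps) \<noteq> 0"
    by (auto simp: fps_eq_iff numeral_fps_const intro!: exI[of _ 0])
  ultimately show ?thesis
    by (metis nonzero_mult_div_cancel_right)
qed

theorem theorem3:
  fixes P :: "nat \<Rightarrow> nat set"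
  assumes "\<And>k. finite (P k)"
    and "\<And>k. card (P k) = k"
    and "\<And>k p. p \<in> P k \<Longrightarrow> prime p"
  shows "(\<forall>Q :: nat set. finite Q \<and> (\<forall>q\<in>Q. prime q) \<longrightarrow>
            rec_divisors (\<Prod>q\<in>Q. q) = rec_divisors (\<Prod>p\<in>P (card Q). p))
       \<and> Abs_fps (\<lambda>k. real (rec_divisors (\<Prod>p\<in>P k. p)) / fact k)
           = fps_exp 1 / (2 - fps_exp 1)"
proof -
  have "rec_divisors (\<Prod>p\<in>P k. p) = rec_divisors_primes k" for k
    using rec_divisors_prod_primes[of "P k"] assms by simp
  then show ?thesis
    using rec_divisors_prod_primes egf_rec_divisors_primes by simp
qed

end
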